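(* Let $A\in\mathbb{R}^{n\times n}$ be invertible, let $U,V\in\mathbb{R}^{n\times k}$ have full column rank, assume $I+V^TA^{-1}U$ is invertible, and let $B=A+UV^T$. Let $\widetilde{A}^{-1}\in\mathbb{R}^{n\times n}$ and $Z^{-1}\in\mathbb{R}^{k\times k}$ be approximate inverses with errors $\epsilon_1=\|\widetilde{A}^{-1}-A^{-1}\|_2$ and $\epsilon_2=\|Z^{-1}-(I+V^T\widetilde{A}^{-1}U)^{-1}\|_2$, where $I+V^T\widetilde{A}^{-1}U$ is invertible, and let $\lambda=\|U\|_2\|V\|_2$. Assume that: (i) $\|I+V^TA^{-1}U\|_2\le\beta$; (ii) the matrices $\widetilde{A}^{-1}$ and $Z^{-1}$ are invertible, and $(Z^{-1})^{-1}-V^T\widetilde{A}^{-1}U$ is invertible; (iii) $\epsilon_1<\dfrac{1}{2\|A\|_2}$; (iv) $\epsilon_2<\dfrac{1}{2(\beta+\lambda\epsilon_1)}$; (v) $2(\beta+\lambda\epsilon_1)^2\epsilon_2<\dfrac12$. Assume moreover that $\epsilon_1\le1$, $\epsilon_2\le1$, $\sigma_{\min}(A)\le1$, and $\lambda\le\frac12\sigma_{\min}(A)$. Then $$\left\|B-\left(\widetilde{A}^{-1}-\widetilde{A}^{-1}UZ^{-1}V^T\widetilde{A}^{-1}\right)^{-1}\right\|_2\le 2\epsilon_1\|A\|_2^2+8\epsilon_2.$$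
   Context: $\|\cdot\|_2$ is the spectral norm, $\sigma_{\min}(A)$ is the smallest singular value of $A$, and $I$ is the identity matrix of appropriate size. $\widetilde{A}^{-1}$ is a single symbol for a given $n\times n$ matrix (the computed approximation of $A^{-1}$), and $Z^{-1}$ is a single symbol for a given $k\times k$ matrix (the computed approximation of $(I+V^T\widetilde{A}^{-1}U)^{-1}$); $(Z^{-1})^{-1}$ is the inverse of the latter matrix. *)

theory Defs
  imports "HOL-Analysis.Analysis"
begin

text \<open>The norm on \<^typ>\<open>real^'n\<close> is Euclidean, so the operator norm of
  the induced linear map is the spectral norm.\<close>

definition spectral_norm :: "real^'n^'m \<Rightarrow> real" where
  "spectral_norm A = onorm ((*v) A)"

text \<open>Square matrices only: for a matrix with more columns than rows, the set below would also
  contain the spurious value 0.\<close>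

definition singular_values :: "real^'n^'n \<Rightarrow> real set" where
  "singular_values A = {sqrt \<mu> |\<mu>. \<exists>v. v \<noteq> 0 \<and> (transpose A ** A) *v v = \<mu> *\<^sub>R v}"

definition sigma_min :: "real^'n^'n \<Rightarrow> real" where
  "sigma_min A = Min (singular_values A)"

end

theory Submission
  imports Defs
begin

text \<open>By the Woodbury identity the error equals
  \<open>(A - Ai\<^sup>-\<^sup>1) + U (I - C) V\<^sup>T\<close> with \<open>C\<^sup>-\<^sup>1 = Zi\<^sup>-\<^sup>1 - V\<^sup>T Ai U\<close>.
  A single perturbation bound,
  \<open>\<parallel>Q - P\<^sup>-\<^sup>1\<parallel> \<le> 2 \<parallel>P - Q\<^sup>-\<^sup>1\<parallel> \<parallel>Q\<parallel>\<^sup>2\<close> whenever \<open>\<parallel>P - Q\<^sup>-\<^sup>1\<parallel> \<parallel>Q\<parallel> \<le> 1/2\<close>,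
  is applied to \<open>(P, Q) = (Ai, A)\<close>, to \<open>(Zi, Z)\<close> with \<open>Z = I + V\<^sup>T Ai U\<close>, and to \<open>(C\<^sup>-\<^sup>1, I)\<close>.
  This bounds the second term by \<open>4 lam \<parallel>Z\<parallel>\<^sup>2 \<epsilon>\<^sub>2\<close>, and the smallness of \<open>lam\<close> relative to
  \<open>sigma_min A\<close> gives \<open>\<parallel>Z\<parallel> \<le> 2\<close> and \<open>lam \<le> 1/2\<close>.\<close>

section \<open>Matrix inverses and the Woodbury identity\<close>

lemma matrix_inv_mult:
  assumes "invertible A"
  shows "A ** matrix_inv A = mat 1" "matrix_inv A ** A = mat 1"
  using someI_ex[OF assms[unfolded invertible_def]] unfolding matrix_inv_def by auto

text \<open>Over a field a one-sided inverse of a square matrix is two-sided, so a single product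
  identifies \<open>matrix_inv\<close>.\<close>

lemma matrix_inv_eqI:
  fixes A B :: "'a::field^'n^'n"
  assumes "A ** B = mat 1"
  shows "matrix_inv B = A"
proof -
  have "invertible B"
    using assms invertible_left_inverse by blast
  then have "A ** (B ** matrix_inv B) = A"
    by (simp add: matrix_inv_mult)
  then show ?thesis
    using assms by (simp add: matrix_mul_assoc)
qed

lemma matrix_diff_ldistrib:
  fixes A :: "'a::ring_1^'n^'m"
  shows "A ** (B - C) = A ** B - A ** C"
  by (simp add: matrix_matrix_mult_def vec_eq_iff right_diff_distrib sum_subtractf)

lemma matrix_diff_rdistrib:
  fixes A :: "'a::ring_1^'n^'m"
  shows "(A - B) ** C = A ** C - B ** C"
  by (simp add: matrix_matrix_mult_def vec_eq_iff left_diff_distrib sum_subtractf)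

lemma matrix_add_rdistrib:
  fixes A :: "'a::ring_1^'n^'m"
  shows "(A + B) ** C = A ** C + B ** C"
  by (simp add: matrix_matrix_mult_def vec_eq_iff distrib_right sum.distrib)

text \<open>One multiplies the claimed inverse by the given matrix. With \<open>C\<close> the
  inverse of \<open>matrix_inv Y - X ** P ** U\<close>, cancelling gives
  \<open>C - C ** X ** P ** U ** Y = Y\<close>, which is exactly what makes the low-rank terms drop
  out.\<close>

lemma woodbury:
  fixes P :: "'a::field^'n^'n" and U :: "'a^'k^'n" and Y :: "'a^'k^'k" and X :: "'a^'n^'k"
  assumes "invertible P" "invertible Y" "invertible (matrix_inv Y - X ** P ** U)"
  shows "matrix_inv (P - P ** U ** Y ** X ** P)
    = matrix_inv P + U ** matrix_inv (matrix_inv Y - X ** P ** U) ** X"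
proof (rule matrix_inv_eqI)
  define C where "C = matrix_inv (matrix_inv Y - X ** P ** U)"
  have "C ** (matrix_inv Y - X ** P ** U) ** Y = Y"
    by (simp add: C_def matrix_inv_mult(2)[OF assms(3)])
  then have "C - C ** X ** P ** U ** Y = Y"
    by (simp add: matrix_diff_ldistrib matrix_diff_rdistrib matrix_mul_assoc
        matrix_inv_mult[OF assms(2)] flip: matrix_mul_assoc[of C "matrix_inv Y" Y])
  then have C: "C ** X ** P = Y ** X ** P + C ** X ** P ** U ** Y ** X ** P"
    by (metis (no_types, lifting) diff_add_cancel matrix_add_rdistrib)
  have "(matrix_inv P + U ** C ** X) ** (P - P ** U ** Y ** X ** P)
    = mat 1 - U ** Y ** X ** P + U ** (C ** X ** P - C ** X ** P ** U ** Y ** X ** P)"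
    by (simp add: matrix_diff_ldistrib matrix_add_rdistrib matrix_mul_assoc
        matrix_inv_mult[OF assms(1)])
  also have "\<dots> = mat 1"
    by (subst C) (simp add: matrix_mul_assoc)
  finally show "(matrix_inv P + U ** matrix_inv (matrix_inv Y - X ** P ** U) ** X)
      ** (P - P ** U ** Y ** X ** P) = mat 1"
    by (simp add: C_def)
qed

section \<open>Basic properties of the spectral norm\<close>

lemma norm_matrix_vector_le: "norm (A *v x) \<le> spectral_norm A * norm x"
  unfolding spectral_norm_def by (rule onorm) (rule matrix_vector_mul_bounded_linear)

lemma spectral_norm_nonneg: "0 \<le> spectral_norm A"
  unfolding spectral_norm_def by (rule onorm_pos_le) (rule matrix_vector_mul_bounded_linear)

lemma spectral_norm_le:
  assumes "\<And>x. norm (A *v x) \<le> c * norm x"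
  shows "spectral_norm A \<le> c"
  unfolding spectral_norm_def using assms by (rule onorm_le)

lemma spectral_norm_eq_0: "spectral_norm A = 0 \<longleftrightarrow> A = 0"
  unfolding spectral_norm_def
  by (subst onorm_eq_0) (auto simp: matrix_eq matrix_vector_mul_bounded_linear)

lemma spectral_norm_mult: "spectral_norm (A ** B) \<le> spectral_norm A * spectral_norm B"
proof (rule spectral_norm_le)
  fix x
  have "norm (A *v (B *v x)) \<le> spectral_norm A * norm (B *v x)"
    by (rule norm_matrix_vector_le)
  also have "\<dots> \<le> spectral_norm A * (spectral_norm B * norm x)"
    by (intro mult_left_mono norm_matrix_vector_le spectral_norm_nonneg)
  finally show "norm (A ** B *v x) \<le> spectral_norm A * spectral_norm B * norm x"
    by (simp add: matrix_vector_mul_assoc mult.assoc)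
qed

lemma spectral_norm_add: "spectral_norm (A + B) \<le> spectral_norm A + spectral_norm B"
proof (rule spectral_norm_le)
  fix x
  show "norm ((A + B) *v x) \<le> (spectral_norm A + spectral_norm B) * norm x"
    using norm_triangle_ineq[of "A *v x" "B *v x"] norm_matrix_vector_le[of A x]
      norm_matrix_vector_le[of B x]
    by (simp add: matrix_vector_mult_add_rdistrib algebra_simps)
qed

lemma spectral_norm_mat_1 [simp]: "spectral_norm (mat 1 :: real^'n^'n) = 1"
proof -
  have "(*v) (mat 1) = (\<lambda>x::real^'n. x)" by (simp add: fun_eq_iff)
  then show ?thesis by (simp add: spectral_norm_def onorm_id)
qed

lemma spectral_norm_minus_commute: "spectral_norm (A - B) = spectral_norm (B - A)"
  by (simp add: spectral_norm_def matrix_vector_mult_diff_rdistrib norm_minus_commute onorm_def)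

text \<open>With \<open>y = transpose A *v x\<close>, the square of \<open>norm y\<close> is the
  inner product of \<open>x\<close> and \<open>A *v y\<close>; Cauchy-Schwarz bounds it, and one
  factor \<open>norm y\<close> cancels.\<close>

lemma spectral_norm_transpose_le: "spectral_norm (transpose A) \<le> spectral_norm A"
proof (rule spectral_norm_le)
  fix x
  let ?y = "transpose A *v x"
  have "norm ?y * norm ?y = x \<bullet> (A *v ?y)"
    by (simp add: power2_norm_eq_inner flip: dot_lmul_matrix power2_eq_square)
  also have "\<dots> \<le> norm x * norm (A *v ?y)"
    by (rule norm_cauchy_schwarz)
  also have "\<dots> \<le> norm x * (spectral_norm A * norm ?y)"
    by (intro mult_left_mono norm_matrix_vector_le) simp
  finally have "norm ?y * norm ?y \<le> (spectral_norm A * norm x) * norm ?y"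
    by (simp add: algebra_simps)
  then show "norm ?y \<le> spectral_norm A * norm x"
    by (cases "?y = 0") (auto simp: spectral_norm_nonneg)
qed

lemma spectral_norm_sandwich:
  "spectral_norm (U ** M ** transpose V) \<le> spectral_norm U * spectral_norm V * spectral_norm M"
proof -
  have "spectral_norm (U ** M ** transpose V) \<le> spectral_norm (U ** M) * spectral_norm (transpose V)"
    by (rule spectral_norm_mult)
  also have "\<dots> \<le> (spectral_norm U * spectral_norm M) * spectral_norm V"
    by (intro mult_mono spectral_norm_mult spectral_norm_transpose_le mult_nonneg_nonneg
        spectral_norm_nonneg)
  finally show ?thesis by (simp add: algebra_simps)
qed

lemma spectral_norm_transpose_sandwich:
  "spectral_norm (transpose V ** M ** U) \<le> spectral_norm U * spectral_norm V * spectral_norm M"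
  using spectral_norm_sandwich[of "transpose V" M "transpose U"]
    mult_mono[OF spectral_norm_transpose_le[of V] spectral_norm_transpose_le[of U]]
  by (simp add: spectral_norm_nonneg)
    (smt (verit) mult.commute mult_right_mono spectral_norm_nonneg)

text \<open>Write p, q, e for the norms of the inverse of \<open>P\<close>, of \<open>Q\<close> and
  of \<open>P - matrix_inv Q\<close>. The identity \<open>eq'\<close> gives p \<le> q + p e q \<le>
  q + p/2, hence p \<le> 2 q by absorption; inserting this into \<open>eq\<close> bounds the
  difference by p e q \<le> 2 e q^2.\<close>

lemma inverse_perturbation_bound:
  fixes P Q :: "real^'n^'n"
  assumes P: "invertible P" and Q: "invertible Q"
    and e: "spectral_norm (P - matrix_inv Q) * spectral_norm Q \<le> 1 / 2"
  shows "spectral_norm (Q - matrix_inv P) \<le> 2 * spectral_norm (P - matrix_inv Q) * (spectral_norm Q)\<^sup>2"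
proof -
  let ?e = "spectral_norm (P - matrix_inv Q)" and ?q = "spectral_norm Q"
    and ?p = "spectral_norm (matrix_inv P)"
  have eq: "Q - matrix_inv P = matrix_inv P ** (P - matrix_inv Q) ** Q"
    by (simp add: matrix_diff_ldistrib matrix_diff_rdistrib matrix_inv_mult[OF P]
        matrix_inv_mult[OF Q] flip: matrix_mul_assoc)
  have eq': "matrix_inv P = Q + matrix_inv P ** (matrix_inv Q - P) ** Q"
    by (simp add: matrix_diff_ldistrib matrix_diff_rdistrib matrix_inv_mult[OF P]
        matrix_inv_mult[OF Q] flip: matrix_mul_assoc)
  have neg: "spectral_norm (matrix_inv Q - P) = ?e"
    by (rule spectral_norm_minus_commute)
  have bd: "spectral_norm (matrix_inv P ** M ** Q) \<le> ?p * (spectral_norm M * ?q)" for M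
    using spectral_norm_mult[of "matrix_inv P" "M ** Q"] spectral_norm_mult[of M Q]
    by (metis (no_types, lifting) matrix_mul_assoc mult_left_mono order_trans spectral_norm_nonneg)
  have "?p \<le> ?q + ?p * (?e * ?q)"
    using spectral_norm_add[of Q "matrix_inv P ** (matrix_inv Q - P) ** Q"]
      bd[of "matrix_inv Q - P"] eq' neg by simp
  moreover have "?p * (?e * ?q) \<le> ?p * (1 / 2)"
    using e by (intro mult_left_mono spectral_norm_nonneg)
  ultimately have "?p \<le> 2 * ?q" by simp
  then have "?p * (?e * ?q) \<le> (2 * ?q) * (?e * ?q)"
    by (intro mult_right_mono mult_nonneg_nonneg spectral_norm_nonneg)
  then show ?thesis
    using bd[of "P - matrix_inv Q"] unfolding eq[symmetric]
    by (simp add: power2_eq_square ac_simps)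
qed

section \<open>The smallest singular value\<close>

lemma transpose_self_mult_inner:
  fixes A :: "real^'n^'m"
  shows "((transpose A ** A) *v x) \<bullet> y = (A *v x) \<bullet> (A *v y)"
  by (metis dot_lmul_matrix matrix_vector_mul_assoc vector_transpose_matrix transpose_transpose)

text \<open>Eigenvectors of the symmetric matrix \<open>A\<^sup>T A\<close> for distinct eigenvalues are orthogonal, so
  there are at most \<open>n\<close> of the latter.\<close>

lemma finite_singular_values:
  fixes A :: "real^'n^'n"
  shows "finite (singular_values A)"
proof -
  let ?M = "transpose A ** A"
  define E where "E = {\<mu>::real. \<exists>v. v \<noteq> 0 \<and> ?M *v v = \<mu> *\<^sub>R v}"
  define w where "w \<mu> = (SOME v. v \<noteq> 0 \<and> ?M *v v = \<mu> *\<^sub>R v)" for \<mu> :: real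
  have w: "w \<mu> \<noteq> 0 \<and> ?M *v w \<mu> = \<mu> *\<^sub>R w \<mu>" if "\<mu> \<in> E" for \<mu>
    using someI_ex[of "\<lambda>v. v \<noteq> 0 \<and> ?M *v v = \<mu> *\<^sub>R v"] that unfolding E_def w_def by blast
  have orth: "w \<mu> \<bullet> w \<nu> = 0" if "\<mu> \<in> E" "\<nu> \<in> E" "\<mu> \<noteq> \<nu>" for \<mu> \<nu>
  proof -
    have "(?M *v w \<mu>) \<bullet> w \<nu> = (?M *v w \<nu>) \<bullet> w \<mu>"
      unfolding transpose_self_mult_inner by (rule inner_commute)
    then have "(\<mu> - \<nu>) * (w \<mu> \<bullet> w \<nu>) = 0"
      using w that by (simp add: algebra_simps inner_commute)
    then show ?thesis using that by simp
  qed
  \<comment> \<open>An eigenvector shared by two distinct eigenvalues would be orthogonal to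
    itself.\<close>
  have "inj_on w E"
    by (rule inj_onI) (metis inner_eq_zero_iff orth w)
  moreover have "independent (w ` E)"
  proof (rule pairwise_orthogonal_independent)
    show "pairwise orthogonal (w ` E)"
      unfolding pairwise_image using orth by (auto simp: pairwise_def orthogonal_def)
    show "0 \<notin> w ` E" using w by force
  qed
  ultimately have "finite E"
    using finite_imageD independent_imp_finite by blast
  moreover have "singular_values A = sqrt ` E"
    by (auto simp: singular_values_def E_def)
  ultimately show ?thesis by simp
qed

text \<open>The minimum \<open>s\<close> of \<open>norm (A *v x)\<close> on the unit sphere is
  attained by compactness, and its minimiser is an eigenvector of \<open>transpose A ** A\<close>
  for \<open>s\<^sup>2\<close>. So \<open>s\<close> is a singular value, and
  \<open>sigma_min A\<close> is at most \<open>s\<close>.\<close>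

lemma sigma_min_mult_norm_le:
  fixes A :: "real^'n^'n"
  shows "sigma_min A * norm x \<le> norm (A *v x)"
proof -
  let ?M = "transpose A ** A"
  have "compact (sphere (0::real^'n) 1)" "sphere (0::real^'n) 1 \<noteq> {}"
    by simp_all
  moreover have "continuous_on (sphere (0::real^'n) 1) (\<lambda>x. norm (A *v x))"
    by (intro continuous_intros linear_continuous_on matrix_vector_mul_bounded_linear)
  ultimately obtain v where v: "norm v = 1" and min: "\<And>y. norm y = 1 \<Longrightarrow> norm (A *v v) \<le> norm (A *v y)"
    using continuous_attains_inf[of "sphere (0::real^'n) 1" "\<lambda>x. norm (A *v x)"] by auto
  define s where "s = norm (A *v v)"
  have le: "s * norm y \<le> norm (A *v y)" for y
  proof (cases "y = 0")
    case False
    then show ?thesis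
      using min[of "(1 / norm y) *\<^sub>R y"]
      by (simp add: s_def matrix_vector_mult_scaleR divide_simps)
  qed simp
  define q where "q y = (A *v y) \<bullet> (A *v y) - s\<^sup>2 * (y \<bullet> y)" for y
  have q_nonneg: "q y \<ge> 0" for y
    using power_mono[OF le[of y], of 2] by (simp add: q_def s_def power2_norm_eq_inner power_mult_distrib)
  define w where "w = ?M *v v - s\<^sup>2 *\<^sub>R v"
  \<comment> \<open>\<open>v\<close> minimises the nonnegative quadratic form \<open>q\<close>; the linear term of \<open>q\<close> at \<open>v\<close> must vanish.\<close>
  have q_line: "q (v + t *\<^sub>R w) = 2 * t * (norm w)\<^sup>2 + t\<^sup>2 * q w" for t
  proof -
    have "q (v + t *\<^sub>R w) = q v + 2 * t * ((A *v v) \<bullet> (A *v w) - s\<^sup>2 * (v \<bullet> w)) + t\<^sup>2 * q w"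
      by (simp add: q_def algebra_simps inner_commute power2_eq_square
          matrix_vector_mult_scaleR)
    moreover have "(A *v v) \<bullet> (A *v w) - s\<^sup>2 * (v \<bullet> w) = (norm w)\<^sup>2"
      by (simp add: w_def power2_norm_eq_inner inner_diff_left flip: transpose_self_mult_inner)
    moreover have "q v = 0"
      by (simp add: q_def s_def v dot_square_norm)
    ultimately show ?thesis by simp
  qed
  have "w = 0"
  proof (rule ccontr)
    assume "w \<noteq> 0"
    \<comment> \<open>Without the 1 this would minimise the parabola \<open>q_line\<close>; adding
      it keeps the denominator positive even if \<open>q w = 0\<close>, and the value at
      \<open>t\<close> is still negative.\<close>
    define t where "t = - (norm w)\<^sup>2 / (q w + 1)"
    have pos: "q w + 1 > 0" "(norm w)\<^sup>2 > 0"
      using q_nonneg[of w] \<open>w \<noteq> 0\<close> by auto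
    have "t < 0"
      using pos by (simp add: t_def)
    have t: "t * (q w + 1) = - (norm w)\<^sup>2"
      using pos by (simp add: t_def)
    have "q (v + t *\<^sub>R w) = t * (2 * (norm w)\<^sup>2 + t * (q w + 1) - t)"
      unfolding q_line by (simp add: power2_eq_square algebra_simps)
    also have "\<dots> = t * ((norm w)\<^sup>2 - t)"
      unfolding t by simp
    also have "\<dots> < 0"
      using \<open>t < 0\<close> pos by (intro mult_neg_pos) linarith+
    finally show False using q_nonneg[of "v + t *\<^sub>R w"] by simp
  qed
  then have "?M *v v = s\<^sup>2 *\<^sub>R v" by (simp add: w_def)
  moreover have "v \<noteq> 0" using v by auto
  moreover have "s = sqrt (s\<^sup>2)" by (simp add: s_def)
  ultimately have "s \<in> singular_values A"
    unfolding singular_values_def by blast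
  then have "sigma_min A \<le> s"
    unfolding sigma_min_def by (intro Min_le finite_singular_values)
  then show ?thesis
    using le[of x] by (meson mult_right_mono norm_ge_zero order_trans)
qed

text \<open>Apply the previous bound to \<open>matrix_inv A *v x\<close>. The product form makes the
  case of nonpositive \<open>sigma_min A\<close> trivial.\<close>

lemma sigma_min_mult_spectral_norm_inv_le:
  fixes A :: "real^'n^'n"
  assumes "invertible A"
  shows "sigma_min A * spectral_norm (matrix_inv A) \<le> 1"
proof (cases "sigma_min A > 0")
  case True
  have "spectral_norm (matrix_inv A) \<le> 1 / sigma_min A"
  proof (rule spectral_norm_le)
    fix x
    show "norm (matrix_inv A *v x) \<le> 1 / sigma_min A * norm x"
      using sigma_min_mult_norm_le[of A "matrix_inv A *v x"] True
      by (simp add: matrix_vector_mul_assoc matrix_inv_mult[OF assms] field_simps)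
  qed
  then show ?thesis using True by (simp add: field_simps)
next
  case False
  then have "sigma_min A * spectral_norm (matrix_inv A) \<le> 0"
    by (intro mult_nonpos_nonneg spectral_norm_nonneg) simp
  then show ?thesis by simp
qed

section \<open>The error bound for the updated inverse\<close>

theorem mainTheorem4:
  fixes A Ai :: "real^'n^'n"
    and U V :: "real^'k^'n"
    and Zi :: "real^'k^'k"
    and B :: "real^'n^'n"
    and \<epsilon>\<^sub>1 \<epsilon>\<^sub>2 lam \<beta> :: real
  assumes "invertible A"
    and "rank U = CARD('k)" and "rank V = CARD('k)"
    and "invertible (mat 1 + transpose V ** matrix_inv A ** U)"
    and "B = A + U ** transpose V"
    and "invertible (mat 1 + transpose V ** Ai ** U)"
    and "\<epsilon>\<^sub>1 = spectral_norm (Ai - matrix_inv A)"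
    and "\<epsilon>\<^sub>2 = spectral_norm (Zi - matrix_inv (mat 1 + transpose V ** Ai ** U))"
    and "lam = spectral_norm U * spectral_norm V"
    and "spectral_norm (mat 1 + transpose V ** matrix_inv A ** U) \<le> \<beta>"
    and "invertible Ai" and "invertible Zi"
    and "invertible (matrix_inv Zi - transpose V ** Ai ** U)"
    and "\<epsilon>\<^sub>1 < 1 / (2 * spectral_norm A)"
    and "\<epsilon>\<^sub>2 < 1 / (2 * (\<beta> + lam * \<epsilon>\<^sub>1))"
    and "2 * (\<beta> + lam * \<epsilon>\<^sub>1)\<^sup>2 * \<epsilon>\<^sub>2 < 1 / 2"
    and "\<epsilon>\<^sub>1 \<le> 1" and "\<epsilon>\<^sub>2 \<le> 1"
    and "sigma_min A \<le> 1" and "lam \<le> sigma_min A / 2"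
  shows "spectral_norm (B - matrix_inv (Ai - Ai ** U ** Zi ** transpose V ** Ai))
           \<le> 2 * \<epsilon>\<^sub>1 * (spectral_norm A)\<^sup>2 + 8 * \<epsilon>\<^sub>2"
proof -
  let ?X = "transpose V"
  define Z where "Z = mat 1 + ?X ** Ai ** U"
  \<comment> \<open>\<open>D\<close> is the inverse of the core matrix that Woodbury produces; it is
    close to the identity because \<open>matrix_inv Zi\<close> is close to \<open>Z\<close>.\<close>
  define D where "D = matrix_inv Zi - ?X ** Ai ** U"
  let ?z = "spectral_norm Z" and ?a = "spectral_norm A"
  note invA = assms(1) and invZ = assms(6)[folded Z_def] and invD = assms(13)[folded D_def]
  note e1 = assms(7) and e2 = assms(8)[folded Z_def] and lam = assms(9)
  have eps: "0 \<le> \<epsilon>\<^sub>1" "0 \<le> \<epsilon>\<^sub>2" "0 \<le> lam"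
    by (auto simp: e1 e2 lam spectral_norm_nonneg)

  have Z_split: "Z = mat 1 + ?X ** matrix_inv A ** U + ?X ** (Ai - matrix_inv A) ** U"
    by (simp add: Z_def matrix_diff_ldistrib matrix_diff_rdistrib)
  have X_err: "spectral_norm (?X ** (Ai - matrix_inv A) ** U) \<le> lam * \<epsilon>\<^sub>1"
    unfolding lam e1 by (rule spectral_norm_transpose_sandwich)
  \<comment> \<open>The norm of \<open>Z\<close> is bounded twice: here in terms of
    \<open>\<beta>\<close>, to match the smallness assumptions on \<open>\<epsilon>\<^sub>2\<close>,
    and in \<open>z_le\<close> by the constant 2 = 1 + 1/2 + 1/2 for the final estimate.\<close>
  have z_beta: "?z \<le> \<beta> + lam * \<epsilon>\<^sub>1"
    using spectral_norm_add[of "mat 1 + ?X ** matrix_inv A ** U" "?X ** (Ai - matrix_inv A) ** U"]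
      X_err assms(10) Z_split by simp
  have "lam * spectral_norm (matrix_inv A) \<le> sigma_min A / 2 * spectral_norm (matrix_inv A)"
    using assms(20) by (intro mult_right_mono spectral_norm_nonneg)
  then have "lam * spectral_norm (matrix_inv A) \<le> 1 / 2"
    using sigma_min_mult_spectral_norm_inv_le[OF invA] by simp
  then have X_inv: "spectral_norm (?X ** matrix_inv A ** U) \<le> 1 / 2"
    using spectral_norm_transpose_sandwich[of V "matrix_inv A" U] lam by simp
  have lam_half: "lam \<le> 1 / 2"
    using assms(19,20) by simp
  then have "lam * \<epsilon>\<^sub>1 \<le> 1 / 2 * 1"
    using eps assms(17) by (intro mult_mono) auto
  then have z_le: "?z \<le> 2"
    using spectral_norm_add[of "mat 1 + ?X ** matrix_inv A ** U" "?X ** (Ai - matrix_inv A) ** U"]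
      spectral_norm_add[of "mat 1" "?X ** matrix_inv A ** U"] X_err X_inv Z_split by simp

  \<comment> \<open>A zero \<open>A\<close> would force \<open>mat 1 = 0\<close>. Positivity of
    \<open>?a\<close> clears the denominator in the bound on
    \<open>\<epsilon>\<^sub>1\<close>.\<close>
  have "A \<noteq> 0"
    using matrix_inv_mult(1)[OF invA] by (metis spectral_norm_eq_0 spectral_norm_mat_1
        matrix_mul_lid matrix_diff_rdistrib cancel_comm_monoid_add_class.diff_cancel zero_neq_one)
  then have "?a > 0"
    using spectral_norm_eq_0[of A] spectral_norm_nonneg[of A] by simp
  then have "\<epsilon>\<^sub>1 * ?a \<le> 1 / 2"
    using assms(14) by (simp add: field_simps)
  then have errA: "spectral_norm (A - matrix_inv Ai) \<le> 2 * \<epsilon>\<^sub>1 * ?a\<^sup>2"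
    using inverse_perturbation_bound[OF assms(11) invA] e1 by simp

  \<comment> \<open>Otherwise the upper bound on the nonnegative \<open>\<epsilon>\<^sub>2\<close>
    would be at most 0 (division by zero yields 0).\<close>
  have "\<beta> + lam * \<epsilon>\<^sub>1 > 0"
    using assms(15) eps by (smt (verit) divide_nonneg_nonpos)
  then have "\<epsilon>\<^sub>2 * (\<beta> + lam * \<epsilon>\<^sub>1) \<le> 1 / 2"
    using assms(15) by (simp add: field_simps)
  then have "\<epsilon>\<^sub>2 * ?z \<le> 1 / 2"
    using mult_left_mono[OF z_beta eps(2)] by simp
  then have errZ: "spectral_norm (Z - matrix_inv Zi) \<le> 2 * \<epsilon>\<^sub>2 * ?z\<^sup>2"
    using inverse_perturbation_bound[OF assms(12) invZ] e2 by simp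
  also have "\<dots> \<le> 2 * \<epsilon>\<^sub>2 * (\<beta> + lam * \<epsilon>\<^sub>1)\<^sup>2"
    using eps z_beta by (intro mult_left_mono power_mono spectral_norm_nonneg) auto
  finally have errZ_half: "spectral_norm (Z - matrix_inv Zi) \<le> 1 / 2"
    using assms(16) by (simp add: algebra_simps)

  have inv_1: "matrix_inv (mat 1 :: real^'k^'k) = mat 1"
    by (simp add: matrix_inv_eqI)
  have inv1: "invertible (mat 1 :: real^'k^'k)"
    by (auto simp: invertible_def)
  have "D - mat 1 = matrix_inv Zi - Z"
    by (simp add: D_def Z_def)
  then have normD: "spectral_norm (D - mat 1) = spectral_norm (Z - matrix_inv Zi)"
    by (simp add: spectral_norm_minus_commute)
  \<comment> \<open>The perturbation bound with \<open>Q = mat 1\<close>; \<open>errZ_half\<close>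
    is its threshold condition.\<close>
  have "spectral_norm (mat 1 - matrix_inv D) \<le> 2 * spectral_norm (Z - matrix_inv Zi)"
    using inverse_perturbation_bound[OF invD inv1] errZ_half normD by (simp add: inv_1)
  then have errC: "spectral_norm (mat 1 - matrix_inv D) \<le> 4 * \<epsilon>\<^sub>2 * ?z\<^sup>2"
    using errZ by simp

  \<comment> \<open>This produces the constant 8: four times \<open>lam * ?z\<^sup>2\<close>, which
    is at most 2.\<close>
  have "lam * ?z\<^sup>2 \<le> 1 / 2 * 2\<^sup>2"
    using lam_half z_le by (intro mult_mono power_mono spectral_norm_nonneg) auto
  then have "(lam * ?z\<^sup>2) * (4 * \<epsilon>\<^sub>2) \<le> 2 * (4 * \<epsilon>\<^sub>2)"
    using eps by (intro mult_right_mono) auto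
  moreover have "lam * spectral_norm (mat 1 - matrix_inv D) \<le> lam * (4 * \<epsilon>\<^sub>2 * ?z\<^sup>2)"
    using errC eps by (intro mult_left_mono)
  moreover have "spectral_norm (U ** (mat 1 - matrix_inv D) ** ?X)
      \<le> lam * spectral_norm (mat 1 - matrix_inv D)"
    unfolding lam by (rule spectral_norm_sandwich)
  ultimately have errU: "spectral_norm (U ** (mat 1 - matrix_inv D) ** ?X) \<le> 8 * \<epsilon>\<^sub>2"
    by (simp add: algebra_simps)

  have "B - matrix_inv (Ai - Ai ** U ** Zi ** ?X ** Ai)
      = (A - matrix_inv Ai) + U ** (mat 1 - matrix_inv D) ** ?X"
    unfolding woodbury[OF assms(11,12,13)] assms(5) D_def[symmetric]
    by (simp add: matrix_diff_ldistrib matrix_diff_rdistrib)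
  then show ?thesis
    using spectral_norm_add[of "A - matrix_inv Ai" "U ** (mat 1 - matrix_inv D) ** ?X"] errA errU
    by simp
qed

end
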